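(* Let $\mathbb{K}$ be an algebraically closed field of characteristic zero, $A=\mathbb{K}[x_1,\dots,x_n]$, and let $D=x_1\partial_2+x_2\partial_3+\dots+x_{n-1}\partial_n$ be the basic Weitzenböck derivation on $A$. Let $a_1,\dots,a_k$ be a (finite) system of isobaric generators of the kernel $A_1=\mathrm{Ker}\,D$ as a subalgebra of $A$, and put $A_i=\mathrm{Ker}\,D^i$ for $i\ge 1$. Then for every $i\ge 1$, $A_i$ is an $A_1$-module and it is generated as an $A_1$-module by the set $$S_i=\Bigl\{\widehat{D}^{k_1}(a_{m_1})\cdots\widehat{D}^{k_t}(a_{m_t})\ \Big|\ t\ge 1,\ a_{m_1},\dots,a_{m_t}\in\{a_1,\dots,a_k\},\ k_1,\dots,k_t\ge 0,\ \sum_{j=1}^t k_j\le i-1\Bigr\},$$ where, by convention, in the definition of $S_i$ one reads $\widehat{D}^0(a_j)=1$ for all $j$.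
   Context: $\partial_i=\partial/\partial x_i$. The linear derivations $\widehat D$ and $H$ of $A$ are defined by $\widehat D(x_i)=i(n-i)x_{i+1}$ (so $\widehat D(x_n)=0$) and $H(x_i)=(n-2i+1)x_i$ for $i=1,\dots,n$. Each monomial $x_1^{\alpha_1}\cdots x_n^{\alpha_n}$ is an eigenvector of $H$ with eigenvalue $\sum_{i=1}^n (n-2i+1)\alpha_i$, called its weight. A polynomial is isobaric if all its monomials have the same weight. *)

theory Defs
  imports
    "HOL-Library.Poly_Mapping"
    "HOL-Computational_Algebra.Polynomial"
    "HOL-Algebra.Embedded_Algebras"
begin

text \<open>
  A multivariate polynomial is a finitely supported map from exponent vectors to coefficients; an
  exponent vector is a finitely supported map from variable indices to exponents. The type admits
  all indices; the restriction to \<open>x\<^sub>1, \<dots>, x\<^sub>n\<close> is made by the carrier of \<open>poly_ring n\<close>.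
\<close>

type_synonym 'k mpol = "(nat \<Rightarrow>\<^sub>0 nat) \<Rightarrow>\<^sub>0 'k"

definition poly_ring :: "nat \<Rightarrow> 'k::comm_ring_1 mpol ring" where
  "poly_ring n = \<lparr>carrier = {p. \<forall>\<alpha>\<in>Poly_Mapping.keys p. Poly_Mapping.keys \<alpha> \<subseteq> {1..n}},
     mult = (*), one = 1, zero = 0, add = (+)\<rparr>"

definition constants :: "'k::comm_ring_1 mpol set" where
  "constants = range (Poly_Mapping.single 0)"

definition var :: "nat \<Rightarrow> 'k::comm_ring_1 mpol" where
  "var i = Poly_Mapping.single (Poly_Mapping.single i 1) 1"

text \<open>The truncated difference of exponent vectors is harmless: when it truncates, the coefficient
  is \<open>0\<close>.\<close>

definition partial_deriv :: "nat \<Rightarrow> 'k::comm_ring_1 mpol \<Rightarrow> 'k mpol" where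
  "partial_deriv i p = (\<Sum>\<alpha>\<in>Poly_Mapping.keys p.
     Poly_Mapping.single (\<alpha> - Poly_Mapping.single i 1)
       (of_nat (Poly_Mapping.lookup \<alpha> i) * Poly_Mapping.lookup p \<alpha>))"

definition weitz :: "nat \<Rightarrow> 'k::comm_ring_1 mpol \<Rightarrow> 'k mpol" where
  "weitz n p = (\<Sum>i=2..n. var (i - 1) * partial_deriv i p)"

text \<open>A derivation of a polynomial ring is determined by the images of the variables: it is
  \<open>\<Sum>\<^sub>i d(x\<^sub>i) \<partial>\<^sub>i\<close>. The defining properties are the lemmas \<open>weitz_hat_var\<close>,
  \<open>weitz_hat_add\<close>, \<open>weitz_hat_const_mult\<close> and \<open>weitz_hat_mult\<close> below.\<close>

definition weitz_hat :: "nat \<Rightarrow> 'k::comm_ring_1 mpol \<Rightarrow> 'k mpol" where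
  "weitz_hat n p = (\<Sum>i=1..n. of_nat (i * (n - i)) * var (i + 1) * partial_deriv i p)"

definition weight :: "nat \<Rightarrow> (nat \<Rightarrow>\<^sub>0 nat) \<Rightarrow> int" where
  "weight n \<alpha> = (\<Sum>i=1..n. (int n - 2 * int i + 1) * int (Poly_Mapping.lookup \<alpha> i))"

definition isobaric :: "nat \<Rightarrow> 'k::comm_ring_1 mpol \<Rightarrow> bool" where
  "isobaric n p \<longleftrightarrow> (\<forall>\<alpha>\<in>Poly_Mapping.keys p. \<forall>\<beta>\<in>Poly_Mapping.keys p. weight n \<alpha> = weight n \<beta>)"

definition weitz_ker :: "nat \<Rightarrow> nat \<Rightarrow> 'k::comm_ring_1 mpol set" where
  "weitz_ker n i = {p \<in> carrier (poly_ring n). (weitz n ^^ i) p = 0}"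

text \<open>The library predicate \<open>subalgebra\<close> only asks for an additive subgroup closed under scalars,
  so closure under products and \<open>1\<close> has to be added.\<close>

definition generated_subalgebra :: "nat \<Rightarrow> 'k::comm_ring_1 mpol set \<Rightarrow> 'k mpol set" where
  "generated_subalgebra n X =
     (\<lambda>B. subring B (poly_ring n) \<and> subalgebra constants B (poly_ring n)) hull X"

text \<open>The kernel of \<open>D\<close> as a ring, and the kernel of \<open>D\<^sup>i\<close> with the action by polynomial
  multiplication. The fields \<open>mult\<close> and \<open>one\<close> of a module record play no role in the module
  laws.\<close>

definition ker_ring :: "nat \<Rightarrow> 'k::comm_ring_1 mpol ring" where
  "ker_ring n = (poly_ring n)\<lparr>carrier := weitz_ker n 1\<rparr>"

definition ker_module :: "nat \<Rightarrow> nat \<Rightarrow> ('k::comm_ring_1 mpol, 'k mpol) module" where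
  "ker_module n i = \<lparr>carrier = weitz_ker n i, mult = (*), one = 1, zero = 0, add = (+),
     smult = (*)\<rparr>"

definition generated_submodule ::
    "('a, 'r) ring_scheme \<Rightarrow> ('a, 'b, 'm) module_scheme \<Rightarrow> 'b set \<Rightarrow> 'b set" where
  "generated_submodule R M X = (\<lambda>N. submodule N R M) hull X"

text \<open>The zeroth power is read as the constant \<open>1\<close>, not as the identity map.\<close>

definition hat_factor :: "nat \<Rightarrow> nat \<Rightarrow> 'k::comm_ring_1 mpol \<Rightarrow> 'k mpol" where
  "hat_factor n e p = (if e = 0 then 1 else (weitz_hat n ^^ e) p)"

text \<open>A list of pairs \<open>(m\<^sub>j, k\<^sub>j)\<close> represents the product of the factors with these indices and
  exponents.\<close>

definition hat_products ::
    "nat \<Rightarrow> nat \<Rightarrow> (nat \<Rightarrow> 'k::comm_ring_1 mpol) \<Rightarrow> nat \<Rightarrow> 'k mpol set" where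
  "hat_products n k a i = {prod_list (map (\<lambda>(m, e). hat_factor n e (a m)) fs) | fs.
     fs \<noteq> [] \<and> fst ` set fs \<subseteq> {1..k} \<and> sum_list (map snd fs) \<le> i - 1}"


lemma partial_deriv_superset:
  assumes "finite S" "Poly_Mapping.keys p \<subseteq> S"
  shows "partial_deriv i p = (\<Sum>\<alpha>\<in>S.
     Poly_Mapping.single (\<alpha> - Poly_Mapping.single i 1)
       (of_nat (Poly_Mapping.lookup \<alpha> i) * Poly_Mapping.lookup p \<alpha>))"
  unfolding partial_deriv_def
  by (rule sum.mono_neutral_left) (use assms in \<open>auto simp: in_keys_iff\<close>)

lemma partial_deriv_zero [simp]: "partial_deriv i 0 = 0"
  by (simp add: partial_deriv_def)

lemma partial_deriv_add: "partial_deriv i (p + q) = partial_deriv i p + partial_deriv i q"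
proof -
  let ?S = "Poly_Mapping.keys p \<union> Poly_Mapping.keys q"
  have "Poly_Mapping.keys (p + q) \<subseteq> ?S" by (rule Poly_Mapping.keys_add)
  then show ?thesis
    by (simp add: partial_deriv_superset[of ?S] lookup_add distrib_left single_add sum.distrib)
qed

lemma partial_deriv_sum: "partial_deriv i (\<Sum>x\<in>X. f x) = (\<Sum>x\<in>X. partial_deriv i (f x))"
  by (induction X rule: infinite_finite_induct) (auto simp: partial_deriv_add)

lemma partial_deriv_single: "partial_deriv i (Poly_Mapping.single \<alpha> c) =
    Poly_Mapping.single (\<alpha> - Poly_Mapping.single i 1) (of_nat (Poly_Mapping.lookup \<alpha> i) * c)"
  by (subst partial_deriv_superset[of "{\<alpha>}"]) auto

lemma mpol_expand:
  "(p :: 'k::comm_ring_1 mpol) =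
    (\<Sum>\<alpha>\<in>Poly_Mapping.keys p. Poly_Mapping.single \<alpha> (Poly_Mapping.lookup p \<alpha>))"
proof (rule poly_mapping_eqI)
  fix \<beta>
  have "Poly_Mapping.lookup (\<Sum>\<alpha>\<in>Poly_Mapping.keys p. Poly_Mapping.single \<alpha> (Poly_Mapping.lookup p \<alpha>)) \<beta>
      = (\<Sum>\<alpha>\<in>Poly_Mapping.keys p. if \<alpha> = \<beta> then Poly_Mapping.lookup p \<alpha> else 0)"
    by (auto simp: lookup_sum lookup_single when_def intro!: sum.cong)
  also have "\<dots> = Poly_Mapping.lookup p \<beta>"
    by (simp add: in_keys_iff)
  finally show "Poly_Mapping.lookup p \<beta> =
      Poly_Mapping.lookup (\<Sum>\<alpha>\<in>Poly_Mapping.keys p. Poly_Mapping.single \<alpha> (Poly_Mapping.lookup p \<alpha>)) \<beta>" ..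
qed

lemma exponent_shift:
  fixes \<alpha> \<beta> :: "nat \<Rightarrow>\<^sub>0 nat"
  assumes "Poly_Mapping.lookup \<alpha> i \<noteq> 0"
  shows "\<alpha> + \<beta> - Poly_Mapping.single i 1 = (\<alpha> - Poly_Mapping.single i 1) + \<beta>"
  by (rule poly_mapping_eqI)
     (use assms in \<open>auto simp: lookup_add lookup_minus lookup_single when_def\<close>)

lemma partial_deriv_mult_single:
  fixes a b :: "'k::comm_ring_1"
  shows "partial_deriv i (Poly_Mapping.single \<alpha> a * Poly_Mapping.single \<beta> b) =
    partial_deriv i (Poly_Mapping.single \<alpha> a) * Poly_Mapping.single \<beta> b
    + Poly_Mapping.single \<alpha> a * partial_deriv i (Poly_Mapping.single \<beta> b)"
proof -
  let ?e = "Poly_Mapping.single i 1 :: nat \<Rightarrow>\<^sub>0 nat"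
  have 1: "Poly_Mapping.single (\<alpha> + \<beta> - ?e) (of_nat (Poly_Mapping.lookup \<alpha> i) * a * b)
      = Poly_Mapping.single ((\<alpha> - ?e) + \<beta>) (of_nat (Poly_Mapping.lookup \<alpha> i) * a * b)"
    by (cases "Poly_Mapping.lookup \<alpha> i = 0") (auto simp: exponent_shift[unfolded One_nat_def])
  have 2: "Poly_Mapping.single (\<alpha> + \<beta> - ?e) (of_nat (Poly_Mapping.lookup \<beta> i) * a * b)
      = Poly_Mapping.single (\<alpha> + (\<beta> - ?e)) (of_nat (Poly_Mapping.lookup \<beta> i) * a * b)"
    using exponent_shift[of \<beta> i \<alpha>]
    by (cases "Poly_Mapping.lookup \<beta> i = 0") (auto simp: add.commute[of \<alpha>])
  have "partial_deriv i (Poly_Mapping.single \<alpha> a * Poly_Mapping.single \<beta> b) =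
      Poly_Mapping.single (\<alpha> + \<beta> - ?e) (of_nat (Poly_Mapping.lookup \<alpha> i) * a * b)
      + Poly_Mapping.single (\<alpha> + \<beta> - ?e) (of_nat (Poly_Mapping.lookup \<beta> i) * a * b)"
    by (simp add: mult_single partial_deriv_single lookup_add algebra_simps flip: single_add)
  also have "\<dots> = partial_deriv i (Poly_Mapping.single \<alpha> a) * Poly_Mapping.single \<beta> b
    + Poly_Mapping.single \<alpha> a * partial_deriv i (Poly_Mapping.single \<beta> b)"
    unfolding 1 2 by (simp add: mult_single partial_deriv_single algebra_simps)
  finally show ?thesis .
qed

lemma partial_deriv_mult:
  fixes p q :: "'k::comm_ring_1 mpol"
  shows "partial_deriv i (p * q) = partial_deriv i p * q + p * partial_deriv i q"
proof -
  have main: "partial_deriv i (sum f X * sum g Y) =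
      partial_deriv i (sum f X) * sum g Y + sum f X * partial_deriv i (sum g Y)"
    if "f = (\<lambda>\<alpha>. Poly_Mapping.single \<alpha> (Poly_Mapping.lookup p \<alpha>))"
      "g = (\<lambda>\<alpha>. Poly_Mapping.single \<alpha> (Poly_Mapping.lookup q \<alpha>))"
    for f g :: "(nat \<Rightarrow>\<^sub>0 nat) \<Rightarrow> 'k mpol" and X Y
    by (simp add: that sum_product partial_deriv_sum partial_deriv_mult_single sum.distrib)
  show ?thesis
    using main[OF refl refl, of "Poly_Mapping.keys p" "Poly_Mapping.keys q"] by (simp flip: mpol_expand)
qed

lemma partial_deriv_const [simp]: "partial_deriv i (Poly_Mapping.single 0 c) = 0"
  by (simp add: partial_deriv_single)

lemma partial_deriv_var: "partial_deriv i (var j) = (if i = j then 1 else 0)"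
  by (auto simp: var_def partial_deriv_single lookup_single)

lemma weitz_var: "weitz n (var i) = (if i \<in> {2..n} then var (i - 1) else 0)"
  by (simp add: weitz_def partial_deriv_var if_distrib cong: if_cong)

lemma weitz_hat_var:
  "i \<in> {1..n} \<Longrightarrow> weitz_hat n (var i) = of_nat (i * (n - i)) * var (i + 1)"
  by (simp add: weitz_hat_def partial_deriv_var if_distrib cong: if_cong)

lemma weitz_hat_add: "weitz_hat n (p + q) = weitz_hat n p + weitz_hat n q"
  by (simp add: weitz_hat_def partial_deriv_add distrib_left sum.distrib)

lemma weitz_hat_mult: "weitz_hat n (p * q) = weitz_hat n p * q + p * weitz_hat n q"
  by (simp only: weitz_hat_def partial_deriv_mult sum_distrib_left sum_distrib_right sum.distrib
      distrib_left mult_ac)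

lemma weitz_hat_const_mult:
  "weitz_hat n (Poly_Mapping.single 0 c * p) = Poly_Mapping.single 0 c * weitz_hat n p"
proof -
  have "weitz_hat n (Poly_Mapping.single 0 c) = 0"
    by (simp add: weitz_hat_def)
  then show ?thesis by (simp add: weitz_hat_mult)
qed

end

theory Submission
  imports Defs
begin

text \<open>
  The operators \<open>D\<close>, \<open>F = weitz_hat n\<close>, \<open>H\<close> form an sl2-triple: \<open>[D, F] = H\<close>, \<open>[H, D] = 2D\<close>, \<open>[H, F] = -2F\<close>,
  and \<open>F\<close> is locally nilpotent. If \<open>f\<close> has weight \<open>\<mu>\<close> and \<open>D\<^sup>i\<^sup>+\<^sup>1 f = 0\<close>, then \<open>h = D\<^sup>i f\<close> is a
  highest weight vector of weight \<open>\<lambda> = \<mu> + 2i\<close>, and \<open>D\<^sup>i F\<^sup>i h\<close> is a multiple of \<open>h\<close>, nonzero unless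
  \<open>\<lambda> < i\<close>; in the latter case \<open>f = 0\<close>, since \<open>D\<^sup>m\<close> is injective on weight \<open>-m\<close>. Subtracting a multiple
  of \<open>F\<^sup>i h\<close> from \<open>f\<close> and inducting on \<open>i\<close> shows that \<open>Ker D\<^sup>i\<close> is the sum of the spaces
  \<open>F\<^sup>j (Ker D)\<close> with \<open>j < i\<close>. By the Leibniz rule \<open>F\<^sup>j\<close> maps polynomials in the \<open>a\<^sub>m\<close> to
  combinations of products of total order at most \<open>j\<close>, the undifferentiated factors being absorbed
  into the coefficients.
\<close>

subsection \<open>Operators satisfying the sl2 relations\<close>

text \<open>The space may be infinite dimensional, as the polynomial ring is. Nilpotency of
  \<open>F\<close> on single vectors, assumed where it is used, replaces finite dimension.\<close>

locale sl2_rep = vector_space scale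
  for scale :: "'a::field_char_0 \<Rightarrow> 'b::ab_group_add \<Rightarrow> 'b" (infixr \<open>*s\<close> 75) +
  fixes E F H :: "'b \<Rightarrow> 'b"
  assumes E_add: "E (u + v) = E u + E v" and E_scale: "E (c *s v) = c *s E v"
    and F_add: "F (u + v) = F u + F v" and F_scale: "F (c *s v) = c *s F v"
    and H_add: "H (u + v) = H u + H v" and H_scale: "H (c *s v) = c *s H v"
    and E_F: "E (F v) = F (E v) + H v"
    and H_E: "H (E v) = E (H v) + 2 *s E v"
    and H_F: "H (F v) = F (H v) - 2 *s F v"
begin

definition weight_space :: "int \<Rightarrow> 'b set" where
  "weight_space \<mu> = {v. H v = of_int \<mu> *s v}"

lemma E_zero [simp]: "E 0 = 0" and F_zero [simp]: "F 0 = 0"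
  using E_scale[of 0 0] F_scale[of 0 0] by simp_all

lemma E_pow_add: "(E ^^ k) (u + v) = (E ^^ k) u + (E ^^ k) v"
  by (induction k) (auto simp: E_add)

lemma E_pow_scale: "(E ^^ k) (c *s v) = c *s (E ^^ k) v"
  by (induction k) (auto simp: E_scale)

lemma F_pow_scale: "(F ^^ k) (c *s v) = c *s (F ^^ k) v"
  by (induction k) (auto simp: F_scale)

lemma E_pow_zero [simp]: "(E ^^ k) 0 = 0"
  by (induction k) auto

lemma F_pow_zero [simp]: "(F ^^ k) 0 = 0"
  by (induction k) auto

lemma E_pow_sum: "(E ^^ k) (\<Sum>x\<in>X. f x) = (\<Sum>x\<in>X. (E ^^ k) (f x))"
  by (induction X rule: infinite_finite_induct) (auto simp: E_pow_add)

lemma E_pow_eq_0_mono: "(E ^^ k) v = 0 \<Longrightarrow> k \<le> l \<Longrightarrow> (E ^^ l) v = 0"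
  using funpow_add[of "l - k" k E] by simp

lemma E_weight_space: "v \<in> weight_space \<mu> \<Longrightarrow> E v \<in> weight_space (\<mu> + 2)"
  by (simp add: weight_space_def H_E E_scale scale_left_distrib)

lemma F_weight_space: "v \<in> weight_space \<mu> \<Longrightarrow> F v \<in> weight_space (\<mu> - 2)"
  by (simp add: weight_space_def H_F F_scale scale_left_diff_distrib)

lemma E_pow_weight_space:
  "v \<in> weight_space \<mu> \<Longrightarrow> (E ^^ k) v \<in> weight_space (\<mu> + 2 * int k)"
proof (induction k)
  case (Suc k)
  then show ?case using E_weight_space[OF Suc.IH[OF Suc.prems]] by (simp add: algebra_simps)
qed simp

lemma F_pow_weight_space:
  "v \<in> weight_space \<mu> \<Longrightarrow> (F ^^ k) v \<in> weight_space (\<mu> - 2 * int k)"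
proof (induction k)
  case (Suc k)
  then show ?case using F_weight_space[OF Suc.IH[OF Suc.prems]] by (simp add: algebra_simps)
qed simp

lemma weight_space_diff:
  "u \<in> weight_space \<mu> \<Longrightarrow> v \<in> weight_space \<mu> \<Longrightarrow> u - v \<in> weight_space \<mu>"
  using H_add[of "u - v" v] by (auto simp: weight_space_def scale_right_diff_distrib algebra_simps)

lemma weight_space_scale: "v \<in> weight_space \<mu> \<Longrightarrow> c *s v \<in> weight_space \<mu>"
  by (simp add: weight_space_def H_scale mult.commute)

text \<open>Moving \<open>E\<close> to the right past each \<open>F\<close> leaves one application
  of \<open>H\<close>, so the constant is the sum of the weights \<mu> - 2t of
  \<open>(F ^^ t) v\<close> for t = 0, ..., k.\<close>

lemma E_F_pow:
  assumes "v \<in> weight_space \<mu>" "E v = 0"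
  shows "E ((F ^^ Suc k) v) = of_int (int (Suc k) * (\<mu> - int k)) *s (F ^^ k) v"
proof (induction k)
  case 0
  then show ?case using assms by (simp add: E_F weight_space_def)
next
  case (Suc k)
  have "H ((F ^^ Suc k) v) = of_int (\<mu> - 2 * int (Suc k)) *s (F ^^ Suc k) v"
    using F_pow_weight_space[OF assms(1), of "Suc k"] by (simp only: weight_space_def mem_Collect_eq)
  moreover have "E ((F ^^ Suc (Suc k)) v) = F (E ((F ^^ Suc k) v)) + H ((F ^^ Suc k) v)"
    by (simp add: E_F)
  ultimately have "E ((F ^^ Suc (Suc k)) v) =
      (of_int (int (Suc k) * (\<mu> - int k)) + of_int (\<mu> - 2 * int (Suc k))) *s (F ^^ Suc k) v"
    by (simp only: Suc.IH F_scale scale_left_distrib) simp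
  moreover have "int (Suc k) * (\<mu> - int k) + (\<mu> - 2 * int (Suc k)) = int (Suc (Suc k)) * (\<mu> - int (Suc k))"
    by (simp add: algebra_simps)
  ultimately show ?case by (simp only: of_int_add[symmetric])
qed

text \<open>The same count with \<open>F\<close> moved to the left past the powers of
  \<open>E\<close>: the weights \<mu> + 2t of \<open>(E ^^ t) v\<close> for t = 0, ..., k add up to
  the constant.\<close>

lemma E_pow_F:
  assumes "v \<in> weight_space \<mu>"
  shows "(E ^^ Suc k) (F v) =
    F ((E ^^ Suc k) v) + of_int (int (Suc k) * (\<mu> + int k)) *s (E ^^ k) v"
proof (induction k)
  case 0
  then show ?case using assms by (simp add: E_F weight_space_def)
next
  case (Suc k)
  have "H ((E ^^ Suc k) v) = of_int (\<mu> + 2 * int (Suc k)) *s (E ^^ Suc k) v"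
    using E_pow_weight_space[OF assms(1), of "Suc k"] by (simp only: weight_space_def mem_Collect_eq)
  moreover have "(E ^^ Suc (Suc k)) (F v) = E ((E ^^ Suc k) (F v))"
    by simp
  ultimately have "(E ^^ Suc (Suc k)) (F v) = F ((E ^^ Suc (Suc k)) v) +
      (of_int (int (Suc k) * (\<mu> + int k)) + of_int (\<mu> + 2 * int (Suc k))) *s (E ^^ Suc k) v"
    by (simp only: Suc.IH E_scale E_add E_F scale_left_distrib) (simp add: add_ac)
  moreover have "int (Suc k) * (\<mu> + int k) + (\<mu> + 2 * int (Suc k)) = int (Suc (Suc k)) * (\<mu> + int (Suc k))"
    by (simp add: algebra_simps)
  ultimately show ?case by (simp only: of_int_add[symmetric])
qed

text \<open>Iterates \<open>E_F_pow\<close>. The product vanishes exactly when 0 \<le> \<mu> < k,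
  the exceptional case to be excluded in \<open>ker_E_pow_decomposition\<close>.\<close>

lemma E_pow_F_pow:
  assumes "v \<in> weight_space \<mu>" "E v = 0"
  shows "(E ^^ k) ((F ^^ k) v) = of_int (\<Prod>t<k. int (Suc t) * (\<mu> - int t)) *s v"
proof (induction k)
  case (Suc k)
  have "(E ^^ Suc k) ((F ^^ Suc k) v) = (E ^^ k) (E ((F ^^ Suc k) v))"
    by (simp only: funpow_Suc_right o_apply)
  then show ?case
    by (simp only: E_F_pow[OF assms] E_pow_scale Suc.IH) (simp add: mult_ac)
qed simp

text \<open>Lowest weight counterpart. The signs come from solving \<open>E_pow_F\<close> for
  \<open>F ((E ^^ Suc k) v)\<close>, its left side being 0.\<close>

lemma F_pow_E_pow:
  assumes "v \<in> weight_space \<mu>" "F v = 0"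
  shows "(F ^^ k) ((E ^^ k) v) = of_int (\<Prod>t<k. - (int (Suc t) * (\<mu> + int t))) *s v"
proof (induction k)
  case (Suc k)
  have "F ((E ^^ Suc k) v) = of_int (- (int (Suc k) * (\<mu> + int k))) *s (E ^^ k) v"
    using E_pow_F[OF assms(1), of k] assms(2) by (simp add: scale_left_diff_distrib eq_neg_iff_add_eq_0 del: funpow.simps)
  moreover have "(F ^^ Suc k) ((E ^^ Suc k) v) = (F ^^ k) (F ((E ^^ Suc k) v))"
    by (simp only: funpow_Suc_right o_apply)
  ultimately show ?case
    by (simp only: F_pow_scale Suc.IH) (simp add: mult_ac)
qed simp

lemma E_pow_F_pow_eq_0:
  assumes "v \<in> weight_space \<mu>" "E v = 0"
  shows "(E ^^ Suc k) ((F ^^ k) v) = 0"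
  by (simp add: E_pow_F_pow[OF assms] E_scale assms)

text \<open>If \<open>v\<close> has weight \<open>-m\<close> and \<open>E\<^sup>m v = 0\<close>, then \<open>F v\<close> has weight \<open>-(m + 2)\<close> and
  \<open>E\<^sup>m\<^sup>+\<^sup>2 (F v) = 0\<close>, so induction on the nilpotency order of \<open>F\<close> gives \<open>F v = 0\<close>.\<close>

lemma E_pow_injective:
  assumes "v \<in> weight_space (- int m)" "(F ^^ N) v = 0" "(E ^^ m) v = 0"
  shows "v = 0"
  using assms
proof (induction N arbitrary: v m)
  case (Suc N)
  have "(E ^^ Suc m) v = 0" "(E ^^ Suc (Suc m)) v = 0"
    using Suc.prems(3) by simp_all
  then have "(E ^^ Suc (Suc m)) (F v) = 0"
    using E_pow_F[OF Suc.prems(1), of "Suc m"] by (simp only: F_zero scale_zero_right add_0_right)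
  moreover have "F v \<in> weight_space (- int (Suc (Suc m)))"
    using F_weight_space[OF Suc.prems(1)] by (simp add: algebra_simps)
  moreover have "(F ^^ N) (F v) = 0"
    using Suc.prems(2) by (simp only: funpow_Suc_right o_apply)
  ultimately have "F v = 0" using Suc.IH by blast
  \<comment> \<open>For weight -m the factors are (t + 1)(m - t), nonzero for t < m, so
    \<open>(E ^^ m) v = 0\<close> forces \<open>v = 0\<close>.\<close>
  from F_pow_E_pow[OF Suc.prems(1) this, of m, symmetric] Suc.prems(3)
  have "(of_int (\<Prod>t<m. - (int (Suc t) * (- int m + int t))) :: 'a) = 0 \<or> v = 0"
    by (simp only: F_pow_zero scale_eq_0_iff)
  moreover have "(\<Prod>t<m. - (int (Suc t) * (- int m + int t))) \<noteq> 0"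
    by (auto simp: prod_zero_iff)
  ultimately show ?case by (metis of_int_eq_0_iff)
qed simp

text \<open>The induction removes the top component \<open>(F ^^ i) g0\<close> first. The invariant
  subspace \<open>U\<close> is carried along because the polynomial type has infinitely many
  variables, while the components must stay within n of them.\<close>

lemma ker_E_pow_decomposition:
  assumes U: "subspace U" "\<And>u. u \<in> U \<Longrightarrow> E u \<in> U" "\<And>u. u \<in> U \<Longrightarrow> F u \<in> U"
    and nil: "\<And>u. u \<in> U \<Longrightarrow> \<exists>N. (F ^^ N) u = 0"
    and "f \<in> U" "f \<in> weight_space \<mu>" "(E ^^ i) f = 0"
  shows "\<exists>g. (\<forall>j<i. g j \<in> U \<and> E (g j) = 0) \<and> f = (\<Sum>j<i. (F ^^ j) (g j))"
  using assms(5-7)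
proof (induction i arbitrary: f)
  case (Suc i)
  define h where "h = (E ^^ i) f"
  have "(E ^^ k) u \<in> U" "(F ^^ k) u \<in> U" if "u \<in> U" for u k
    using that U by (induction k) auto
  note pow = this
  have h: "E h = 0" "h \<in> weight_space (\<mu> + 2 * int i)" "h \<in> U"
    using Suc.prems E_pow_weight_space pow by (auto simp: h_def)
  define c :: 'a where "c = of_int (\<Prod>t<i. int (Suc t) * (\<mu> + 2 * int i - int t))"
  have c: "(E ^^ i) ((F ^^ i) h) = c *s h"
    using E_pow_F_pow[OF h(2,1)] by (simp add: c_def)
  \<comment> \<open>This form covers both cases: \<open>b\<close> inverts a nonzero
    \<open>c\<close>, and any \<open>b\<close> works when \<open>h = 0\<close>.\<close>
  have "\<exists>b. (b * c) *s h = h"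
  proof (cases "\<mu> + int i \<ge> 0")
    case True
    \<comment> \<open>Each factor contains \<mu> + 2i - t \<ge> i - t > 0.\<close>
    then have "c \<noteq> 0" by (auto simp: c_def prod_zero_iff simp del: of_int_prod)
    then show ?thesis by (intro exI[of _ "inverse c"]) simp
  next
    case False
    obtain N where "(F ^^ N) f = 0" using nil Suc.prems by blast
    \<comment> \<open>Here -\<mu> \<ge> i + 1, so the hypothesis on \<open>E ^^ Suc i\<close>
      suffices, and \<open>E_pow_injective\<close> applies with m = -\<mu>.\<close>
    moreover have "(E ^^ nat (- \<mu>)) f = 0"
      using False Suc.prems by (intro E_pow_eq_0_mono[OF Suc.prems(3)]) auto
    ultimately have "f = 0"
      using E_pow_injective[of f "nat (- \<mu>)"] False Suc.prems by auto
    then show ?thesis by (simp add: h_def)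
  qed
  then obtain b where b: "(b * c) *s h = h" ..
  \<comment> \<open>The scalar makes \<open>(F ^^ i) g0\<close> and \<open>f\<close> agree under
    \<open>E ^^ i\<close>. Their difference is killed one power earlier and still has weight
    \<mu>.\<close>
  define g0 where "g0 = b *s h"
  have g0: "g0 \<in> U" "E g0 = 0"
    using h U(1) by (auto simp: g0_def E_scale subspace_scale)
  have "(F ^^ i) g0 \<in> weight_space \<mu>"
    using F_pow_weight_space[OF weight_space_scale[OF h(2), of b], of i] by (simp add: g0_def)
  moreover have "(E ^^ i) (f - (F ^^ i) g0) = 0"
  proof -
    have "(E ^^ i) ((F ^^ i) g0) = (E ^^ i) f"
      using b by (simp add: g0_def F_pow_scale E_pow_scale c flip: h_def)
    then show ?thesis
      using E_pow_add[of i "f - (F ^^ i) g0" "(F ^^ i) g0"] by simp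
  qed
  moreover have "f - (F ^^ i) g0 \<in> U"
    using U(1) Suc.prems pow(2)[OF g0(1)] by (simp add: subspace_diff)
  ultimately obtain g where g: "\<forall>j<i. g j \<in> U \<and> E (g j) = 0"
      "f - (F ^^ i) g0 = (\<Sum>j<i. (F ^^ j) (g j))"
    using Suc.IH[of "f - (F ^^ i) g0"] weight_space_diff Suc.prems(2) by blast
  have "f = (\<Sum>j<i. (F ^^ j) (g j)) + (F ^^ i) g0"
    using g(2) by (simp add: diff_eq_eq)
  then have "f = (\<Sum>j<Suc i. (F ^^ j) ((g(i := g0)) j))" by simp
  moreover have "\<forall>j<Suc i. (g(i := g0)) j \<in> U \<and> E ((g(i := g0)) j) = 0"
    using g(1) g0 by (auto simp: less_Suc_eq)
  ultimately show ?case by blast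
qed simp

end

section \<open>Induction over sums and products of constants and variables\<close>

lemma single_eq_const_mult:
  "Poly_Mapping.single \<alpha> c = Poly_Mapping.single 0 c * (Poly_Mapping.single \<alpha> 1 :: 'k::comm_ring_1 mpol)"
  by (simp add: mult_single)

lemma var_power: "(var i :: 'k::comm_ring_1 mpol) ^ m = Poly_Mapping.single (Poly_Mapping.single i m) 1"
  by (induction m) (auto simp: var_def mult_single single_one simp flip: single_add)

text \<open>Constants and variables generate all polynomials, which reduces identities between
  derivations to the variables.\<close>

lemma mpol_induct [case_names const var add mult]:
  fixes p :: "'k::comm_ring_1 mpol"
  assumes const: "\<And>c. P (Poly_Mapping.single 0 c)" and var: "\<And>i. P (var i)"
    and add: "\<And>p q. P p \<Longrightarrow> P q \<Longrightarrow> P (p + q)" and mult: "\<And>p q. P p \<Longrightarrow> P q \<Longrightarrow> P (p * q)"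
  shows "P p"
proof -
  have one: "P 1" using const[of 1] by (simp add: single_one)
  have zero: "P 0" using const[of 0] by simp
  have pow: "P (var i ^ m)" for i m
    by (induction m) (auto intro: one var mult)
  have mon: "P (Poly_Mapping.single \<alpha> 1)" for \<alpha>
  proof (induction \<alpha> rule: Poly_Mapping.update_induct)
    case const
    then show ?case using one by (simp add: single_one)
  next
    case (update \<alpha> i m)
    \<comment> \<open>The index \<open>i\<close> is fresh, so updating is adding, and the monomial
      gains the factor \<open>var i ^ m\<close>.\<close>
    have "Poly_Mapping.update i m \<alpha> = \<alpha> + Poly_Mapping.single i m"
      using update.hyps(1)
      by (intro poly_mapping_eqI) (auto simp: lookup_update lookup_add lookup_single in_keys_iff when_def)
    then have "Poly_Mapping.single (Poly_Mapping.update i m \<alpha>) 1 = Poly_Mapping.single \<alpha> 1 * (var i ^ m :: 'k mpol)"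
      by (simp add: var_power mult_single)
    then show ?case using update.IH pow mult by metis
  qed
  have monomial: "P (Poly_Mapping.single \<alpha> c)" for \<alpha> c
    by (subst single_eq_const_mult) (rule mult[OF const mon])
  have "P (\<Sum>\<alpha>\<in>X. Poly_Mapping.single \<alpha> (Poly_Mapping.lookup p \<alpha>))" for X
    by (induction X rule: infinite_finite_induct)
      (simp_all add: zero add monomial)
  then show ?thesis using mpol_expand[of p] by metis
qed

subsection \<open>Derivations\<close>

text \<open>Vanishing on constants encodes linearity over the coefficients: with the Leibniz rule it
  yields \<open>derivation_const_mult\<close>.\<close>

definition derivation :: "('k::comm_ring_1 mpol \<Rightarrow> 'k mpol) \<Rightarrow> bool" where
  "derivation d \<longleftrightarrow> (\<forall>p q. d (p + q) = d p + d q) \<and> (\<forall>p q. d (p * q) = d p * q + p * d q)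
     \<and> (\<forall>c. d (Poly_Mapping.single 0 c) = 0)"

lemma derivation_add: "derivation d \<Longrightarrow> d (p + q) = d p + d q"
  and derivation_mult: "derivation d \<Longrightarrow> d (p * q) = d p * q + p * d q"
  and derivation_const: "derivation d \<Longrightarrow> d (Poly_Mapping.single 0 c) = 0"
  by (simp_all add: derivation_def)

lemma derivation_zero: "derivation d \<Longrightarrow> d 0 = 0"
  using derivation_const[of d 0] by simp

lemma derivation_const_mult:
  "derivation d \<Longrightarrow> d (Poly_Mapping.single 0 c * p) = Poly_Mapping.single 0 c * d p"
  by (simp add: derivation_mult derivation_const)

lemma of_int_mpol: "(of_int z :: 'k::comm_ring_1 mpol) = Poly_Mapping.single 0 (of_int z)"
proof -
  have nat: "(of_nat m :: 'k mpol) = Poly_Mapping.single 0 (of_nat m)" for m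
    by (induction m) (auto simp: single_add single_one)
  show ?thesis
    by (cases z) (simp_all only: of_int_of_nat_eq of_int_minus nat single_uminus)
qed

lemma of_nat_mpol: "(of_nat m :: 'k::comm_ring_1 mpol) = Poly_Mapping.single 0 (of_nat m)"
  using of_int_mpol[of "int m"] by simp

lemma derivation_of_int_mult: "derivation d \<Longrightarrow> d (of_int z * p) = of_int z * d p"
  by (simp only: of_int_mpol derivation_const_mult)

lemma derivation_of_nat_mult: "derivation d \<Longrightarrow> d (of_nat z * p) = of_nat z * d p"
  by (simp only: of_nat_mpol derivation_const_mult)

lemma derivation_eqI:
  assumes "derivation d" "derivation e" "\<And>i. d (var i) = e (var i)"
  shows "d p = e p"
  by (induction p rule: mpol_induct)
    (simp_all add: assms(3) derivation_add[OF assms(1)] derivation_add[OF assms(2)]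
      derivation_mult[OF assms(1)] derivation_mult[OF assms(2)]
      derivation_const[OF assms(1)] derivation_const[OF assms(2)])

text \<open>The mixed products \<open>d p * e q\<close> and \<open>e p * d q\<close> occur in both
  compositions and cancel.\<close>

lemma derivation_commutator:
  assumes "derivation d" "derivation e"
  shows "derivation (\<lambda>p. d (e p) - e (d p))"
  unfolding derivation_def
  by (simp add: derivation_add[OF assms(1)] derivation_add[OF assms(2)]
      derivation_mult[OF assms(1)] derivation_mult[OF assms(2)]
      derivation_const[OF assms(1)] derivation_const[OF assms(2)]
      derivation_zero[OF assms(1)] derivation_zero[OF assms(2)] algebra_simps)

lemma derivation_scaled: "derivation d \<Longrightarrow> derivation (\<lambda>p. u * d p)"
  by (simp add: derivation_def algebra_simps)

lemma derivation_sum: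
  "(\<And>i. i \<in> I \<Longrightarrow> derivation (d i)) \<Longrightarrow> derivation (\<lambda>p. \<Sum>i\<in>I. d i p)"
  by (simp add: derivation_def sum.distrib sum_distrib_left sum_distrib_right)

lemma derivation_partial_deriv: "derivation (partial_deriv i)"
  by (simp add: derivation_def partial_deriv_add partial_deriv_mult)

text \<open>In the Leibniz expansion every term has r derivatives on \<open>p\<close> and c - r on
  \<open>q\<close>; the bound forces r \<ge> a or c - r \<ge> b. The induction peels off one
  derivative at a time and so avoids binomial coefficients.\<close>

lemma derivation_pow_mult_eq_0:
  assumes "derivation d" "(d ^^ a) p = 0" "(d ^^ b) q = 0" "a + b \<le> Suc c"
  shows "(d ^^ c) (p * q) = 0"
  using assms(2-4)
proof (induction c arbitrary: a b p q)
  case 0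
  then have "a = 0 \<or> b = 0" by auto
  then show ?case using 0 by auto
next
  case (Suc c)
  have zero: "(d ^^ m) 0 = 0" for m
    by (induction m) (auto simp: derivation_zero[OF assms(1)])
  have add: "(d ^^ m) (u + v) = (d ^^ m) u + (d ^^ m) v" for m u v
    by (induction m) (auto simp: derivation_add[OF assms(1)])
  show ?case
  proof (cases "a = 0 \<or> b = 0")
    case True
    then show ?thesis using Suc.prems zero[of "Suc c"] by auto
  next
    case False
    then obtain a' b' where ab: "a = Suc a'" "b = Suc b'"
      using not0_implies_Suc by blast
    have "(d ^^ c) (d p * q) = 0"
      using Suc.prems ab by (intro Suc.IH[of a' "d p" b q]) (auto simp: funpow_Suc_right simp del: funpow.simps)
    moreover have "(d ^^ c) (p * d q) = 0"
      using Suc.prems ab by (intro Suc.IH[of a p b' "d q"]) (auto simp: funpow_Suc_right simp del: funpow.simps)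
    ultimately show ?thesis
      by (simp add: funpow_Suc_right derivation_mult[OF assms(1)] add del: funpow.simps)
  qed
qed

subsection \<open>The sl2-triple of the Weitzenboeck derivation\<close>

text \<open>This is the derivation H; by \<open>lookup_weight_op\<close> its eigenvalue on a
  monomial is \<open>weight\<close>.\<close>

definition weight_op :: "nat \<Rightarrow> 'k::comm_ring_1 mpol \<Rightarrow> 'k mpol" where
  "weight_op n p = (\<Sum>i=1..n. of_int (int n - 2 * int i + 1) * (var i * partial_deriv i p))"

lemma derivation_weitz: "derivation (weitz n)"
  unfolding weitz_def[abs_def]
  by (intro derivation_sum derivation_scaled derivation_partial_deriv)

lemma derivation_weitz_hat: "derivation (weitz_hat n)"
  unfolding weitz_hat_def[abs_def]
  by (intro derivation_sum derivation_scaled derivation_partial_deriv)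

lemma derivation_weight_op: "derivation (weight_op n)"
  unfolding weight_op_def[abs_def]
  by (intro derivation_sum derivation_scaled derivation_partial_deriv)

lemma weitz_hat_var_outside: "i \<notin> {1..n} \<Longrightarrow> weitz_hat n (var i) = 0"
  unfolding weitz_hat_def by (intro sum.neutral) (auto simp: partial_deriv_var)

lemma weight_op_var:
  "weight_op n (var i) = (if i \<in> {1..n} then of_int (int n - 2 * int i + 1) * var i else 0)"
  by (simp add: weight_op_def partial_deriv_var if_distrib cong: if_cong)

text \<open>Both sides are derivations, so variables suffice. Outside 1, ..., n all three operators
  vanish; inside, i(n - i) - (i - 1)(n - i + 1) = n - 2i + 1.\<close>

lemma weitz_weitz_hat_commutator: "weitz n (weitz_hat n p) = weitz_hat n (weitz n p) + weight_op n p"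
proof -
  have "weitz n (weitz_hat n (var i)) - weitz_hat n (weitz n (var i)) = (weight_op n (var i) :: 'a mpol)" for i
  proof (cases "i \<in> {1..n}")
    case False
    then show ?thesis
      by (auto simp: weitz_hat_var_outside weitz_var weight_op_var derivation_zero[OF derivation_weitz]
        derivation_zero[OF derivation_weitz_hat])
  next
    case True
    \<comment> \<open>Eliminates truncated subtraction: the two coefficients become (j + 1)r and j(r
      + 1), with difference r - j.\<close>
    then obtain j r where jr: "i = Suc j" "n = i + r"
      by (metis atLeastAtMost_iff le_Suc_ex not0_implies_Suc not_one_le_zero)
    have "weitz n (weitz_hat n (var i)) = (of_int (int (Suc j) * int r) * var i :: 'a mpol)"
    proof -
      have "weitz_hat n (var i) = (of_int (int (Suc j) * int r) * var (Suc i) :: 'a mpol)"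
        using jr weitz_hat_var[OF True] by (simp add: algebra_simps)
      \<comment> \<open>The case r = 0 is i = n, where the next variable is out of range but its
        coefficient is 0.\<close>
      then show ?thesis
        using jr by (cases r) (auto simp: derivation_of_int_mult[OF derivation_weitz] weitz_var
            derivation_zero[OF derivation_weitz] simp del: of_int_mult)
    qed
    moreover have "weitz_hat n (weitz n (var i)) = (of_int (int j * (int r + 1)) * var i :: 'a mpol)"
      using True jr
      by (cases j) (auto simp: weitz_hat_var weitz_var derivation_zero[OF derivation_weitz_hat] algebra_simps)
    moreover have "weight_op n (var i) = (of_int (int r - int j) * var i :: 'a mpol)"
      using True jr by (simp add: weight_op_var)
    ultimately show ?thesis by (simp add: algebra_simps)
  qed
  then have "weitz n (weitz_hat n p) - weitz_hat n (weitz n p) = weight_op n p"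
    by (rule derivation_eqI[OF derivation_commutator[OF derivation_weitz derivation_weitz_hat] derivation_weight_op])
  then show ?thesis by (simp add: algebra_simps)
qed

lemma weight_op_weitz: "weight_op n (weitz n p) = weitz n (weight_op n p) + 2 * weitz n p"
proof -
  have "weight_op n (weitz n (var i)) - weitz n (weight_op n (var i)) = (2 * weitz n (var i) :: 'a mpol)" for i
  proof (cases "i \<in> {2..n}")
    case True
    define w where "w = int n - 2 * int i + 1"
    have "weight_op n (var i) = (of_int w * var i :: 'a mpol)"
      using True by (simp only: weight_op_var w_def) simp
    moreover have "i - 1 \<in> {1..n}" "int n - 2 * int (i - 1) + 1 = w + 2"
      using True by (auto simp: w_def)
    then have "weight_op n (var (i - 1)) = (of_int (w + 2) * var (i - 1) :: 'a mpol)"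
      by (simp only: weight_op_var if_True)
    ultimately show ?thesis
      using True by (simp add: weitz_var derivation_of_int_mult[OF derivation_weitz] distrib_right)
  next
    case False
    then show ?thesis
      by (simp add: weitz_var weight_op_var derivation_of_int_mult[OF derivation_weitz]
          derivation_zero[OF derivation_weitz] derivation_zero[OF derivation_weight_op] del: of_int_add of_int_diff)
  qed
  then have "weight_op n (weitz n p) - weitz n (weight_op n p) = 2 * weitz n p"
    by (rule derivation_eqI[OF derivation_commutator[OF derivation_weight_op derivation_weitz]
          derivation_scaled[OF derivation_weitz]])
  then show ?thesis by (simp add: algebra_simps)
qed

lemma weight_op_weitz_hat: "weight_op n (weitz_hat n p) = weitz_hat n (weight_op n p) - 2 * weitz_hat n p"
proof -
  have "weight_op n (weitz_hat n (var i)) - weitz_hat n (weight_op n (var i)) = ((-2) * weitz_hat n (var i) :: 'a mpol)" for i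
  proof (cases "i \<in> {1..n}")
    case True
    define w where "w = int n - 2 * int i + 1"
    define c where "c = i * (n - i)"
    have hat: "weitz_hat n (var i) = (of_nat c * var (i + 1) :: 'a mpol)"
      using weitz_hat_var[OF True] by (simp only: c_def)
    have "weight_op n (var i) = (of_int w * var i :: 'a mpol)"
      using True by (simp only: weight_op_var w_def) simp
    then have "weitz_hat n (weight_op n (var i)) = (of_int w * (of_nat c * var (i + 1)) :: 'a mpol)"
      by (simp only: derivation_of_int_mult[OF derivation_weitz_hat] hat)
    \<comment> \<open>For i = n the operator kills the out-of-range variable, and the right side
      agrees because \<open>c = 0\<close>.\<close>
    moreover have "of_nat c * weight_op n (var (i + 1)) = (of_nat c * (of_int (w - 2) * var (i + 1)) :: 'a mpol)"
      using True by (cases "i = n") (simp_all add: c_def weight_op_var w_def algebra_simps)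
    ultimately show ?thesis
      by (simp add: hat derivation_of_nat_mult[OF derivation_weight_op] algebra_simps)
  next
    case False
    then show ?thesis
      unfolding weitz_hat_var_outside[OF False]
      by (simp only: weight_op_var if_False derivation_zero[OF derivation_weitz_hat]
          derivation_zero[OF derivation_weight_op]) simp
  qed
  then have "weight_op n (weitz_hat n p) - weitz_hat n (weight_op n p) = (-2) * weitz_hat n p"
    by (rule derivation_eqI[OF derivation_commutator[OF derivation_weight_op derivation_weitz_hat]
          derivation_scaled[OF derivation_weitz_hat]])
  then show ?thesis by (simp add: algebra_simps)
qed

section \<open>Local nilpotency and the sl2 structure on polynomials\<close>

lemma weitz_hat_pow_const_mult:
  "(weitz_hat n ^^ j) (Poly_Mapping.single 0 c * p) = Poly_Mapping.single 0 c * (weitz_hat n ^^ j) p"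
  by (induction j) (auto simp: weitz_hat_const_mult)

lemma weitz_hat_pow_add: "(weitz_hat n ^^ j) (p + q) = (weitz_hat n ^^ j) p + (weitz_hat n ^^ j) q"
  by (induction j) (auto simp: weitz_hat_add)

lemma weitz_hat_pow_zero [simp]: "(weitz_hat n ^^ j) 0 = 0"
  by (induction j) (auto simp: derivation_zero[OF derivation_weitz_hat])

lemma weitz_hat_pow_eq_0_mono:
  assumes "(weitz_hat n ^^ k) p = 0" "k \<le> l"
  shows "(weitz_hat n ^^ l) p = 0"
proof -
  obtain d where "l = d + k" using assms(2) by (metis le_add_diff_inverse2)
  then show ?thesis by (simp add: funpow_add assms(1))
qed

text \<open>Each application raises the index of a variable until the last one is killed. Leibniz
  carries nilpotency over to products.\<close>

lemma weitz_hat_locally_nilpotent: "\<exists>N. (weitz_hat n ^^ N) p = 0"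
proof (induction p rule: mpol_induct)
  case (const c)
  then show ?case by (intro exI[of _ 1]) (simp add: derivation_const[OF derivation_weitz_hat])
next
  case (var i)
  show ?case
  proof (cases "i \<in> {1..n}")
    case True
    then show ?thesis
    proof (induction "n - i" arbitrary: i)
      case 0
      then show ?case by (intro exI[of _ 1]) (simp add: weitz_hat_var)
    next
      case (Suc r)
      then obtain N where N: "(weitz_hat n ^^ N) (var (Suc i) :: 'a mpol) = 0"
        using Suc.hyps(1)[of "Suc i"] Suc.hyps(2) Suc.prems by fastforce
      have "weitz_hat n (var i) = Poly_Mapping.single 0 (of_nat (i * (n - i))) * (var (Suc i) :: 'a mpol)"
        using Suc.prems by (simp only: weitz_hat_var of_nat_mpol Suc_eq_plus1)
      then have "(weitz_hat n ^^ Suc N) (var i :: 'a mpol) = 0"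
        by (simp add: funpow_Suc_right weitz_hat_pow_const_mult N del: funpow.simps)
      then show ?case ..
    qed
  next
    case False
    then show ?thesis by (intro exI[of _ 1]) (simp add: weitz_hat_var_outside)
  qed
next
  case (add p q)
  then obtain N M where "(weitz_hat n ^^ N) p = 0" "(weitz_hat n ^^ M) q = 0" by blast
  then have "(weitz_hat n ^^ (N + M)) (p + q) = 0"
    using weitz_hat_pow_eq_0_mono[of N n p "N + M"] weitz_hat_pow_eq_0_mono[of M n q "N + M"]
    by (simp add: weitz_hat_pow_add)
  then show ?case ..
next
  case (mult p q)
  then obtain N M where "(weitz_hat n ^^ N) p = 0" "(weitz_hat n ^^ M) q = 0" by blast
  then have "(weitz_hat n ^^ (N + M)) (p * q) = 0"
    by (rule derivation_pow_mult_eq_0[OF derivation_weitz_hat]) simp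
  then show ?case ..
qed

abbreviation (input) const_scale :: "'k::comm_ring_1 \<Rightarrow> 'k mpol \<Rightarrow> 'k mpol" where
  "const_scale c p \<equiv> Poly_Mapping.single 0 c * p"

text \<open>Scalars act as multiplication by constant polynomials.\<close>

interpretation weitz: sl2_rep "const_scale :: 'k::field_char_0 \<Rightarrow> _" "weitz n" "weitz_hat n" "weight_op n" for n
proof (unfold_locales, goal_cases)
  case (1 a x y)
  show ?case by (rule distrib_left)
next
  case (2 a b x)
  show ?case by (simp only: single_add distrib_right)
next
  case (3 a b x)
  show ?case by (simp add: mult_single flip: mult.assoc)
next
  case (4 x)
  show ?case by (simp add: single_one)
next
  case 5
  show ?case by (rule derivation_add[OF derivation_weitz])
next
  case 6
  show ?case by (rule derivation_const_mult[OF derivation_weitz])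
next
  case 7
  show ?case by (rule derivation_add[OF derivation_weitz_hat])
next
  case 8
  show ?case by (rule derivation_const_mult[OF derivation_weitz_hat])
next
  case 9
  show ?case by (rule derivation_add[OF derivation_weight_op])
next
  case 10
  show ?case by (rule derivation_const_mult[OF derivation_weight_op])
next
  case 11
  show ?case by (rule weitz_weitz_hat_commutator)
next
  case (12 v)
  show ?case using weight_op_weitz[of n v] by simp
next
  case (13 v)
  show ?case using weight_op_weitz_hat[of n v] by simp
qed

subsection \<open>Weight spaces\<close>

text \<open>The Euler operator \<open>var i * partial_deriv i\<close> multiplies a monomial by its
  exponent of \<open>var i\<close>.\<close>

lemma lookup_weight_op:
  "Poly_Mapping.lookup (weight_op n p) \<alpha> = of_int (weight n \<alpha>) * Poly_Mapping.lookup p (\<alpha> :: nat \<Rightarrow>\<^sub>0 nat)"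
proof -
  have "var i * partial_deriv i (Poly_Mapping.single \<beta> c) =
      Poly_Mapping.single \<beta> (of_nat (Poly_Mapping.lookup \<beta> i) * c)" for i \<beta> and c :: 'a
  proof (cases "Poly_Mapping.lookup \<beta> i = 0")
    case True
    then show ?thesis by (simp add: partial_deriv_single)
  next
    case False
    then have "Poly_Mapping.single i 1 + (\<beta> - Poly_Mapping.single i 1) = \<beta>"
      by (intro poly_mapping_eqI) (auto simp: lookup_add lookup_minus lookup_single when_def)
    then show ?thesis by (simp add: partial_deriv_single var_def mult_single)
  qed
  then have mono: "weight_op n (Poly_Mapping.single \<beta> c) = Poly_Mapping.single \<beta> (of_int (weight n \<beta>) * c)"
    for \<beta> and c :: 'a
    by (intro poly_mapping_eqI)
      (auto simp: weight_op_def weight_def of_int_mpol mult_single lookup_sum lookup_single when_def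
        sum_distrib_right mult.assoc simp del: single_of_int of_int_add of_int_diff)
  have sum: "weight_op n (sum f X) = (\<Sum>x\<in>X. weight_op n (f x))" for f :: "(nat \<Rightarrow>\<^sub>0 nat) \<Rightarrow> 'a mpol" and X
    by (induction X rule: infinite_finite_induct)
      (auto simp: derivation_add[OF derivation_weight_op] derivation_zero[OF derivation_weight_op])
  have "weight_op n p = (\<Sum>\<beta>\<in>Poly_Mapping.keys p. Poly_Mapping.single \<beta> (of_int (weight n \<beta>) * Poly_Mapping.lookup p \<beta>))"
    by (subst (1) mpol_expand[of p]) (simp only: sum mono)
  also have "Poly_Mapping.lookup \<dots> \<alpha> =
      (\<Sum>\<beta>\<in>Poly_Mapping.keys p. if \<beta> = \<alpha> then of_int (weight n \<alpha>) * Poly_Mapping.lookup p \<alpha> else 0)"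
    by (auto simp: lookup_sum lookup_single when_def intro!: sum.cong)
  also have "\<dots> = of_int (weight n \<alpha>) * Poly_Mapping.lookup p \<alpha>"
    by (simp add: in_keys_iff)
  finally show ?thesis .
qed

text \<open>In characteristic zero distinct integer weights are distinct eigenvalues. This links
  \<open>isobaric\<close> to the weight spaces.\<close>

lemma mem_weight_space_iff:
  fixes p :: "'k::field_char_0 mpol"
  shows "p \<in> weitz.weight_space n \<mu> \<longleftrightarrow> (\<forall>\<alpha>\<in>Poly_Mapping.keys p. weight n \<alpha> = \<mu>)"
proof -
  have lookup_scale: "Poly_Mapping.lookup (const_scale c q) \<alpha> = c * Poly_Mapping.lookup q \<alpha>" for c and q :: "'k mpol" and \<alpha>
    by (simp add: Poly_Mapping.map.rep_eq when_def flip: mult_map_scale_conv_mult)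
  show ?thesis
    by (auto simp: weitz.weight_space_def poly_mapping_eq_iff fun_eq_iff lookup_weight_op lookup_scale in_keys_iff
        simp del: single_of_int)
qed

text \<open>Different weights involve disjoint sets of monomials, so nothing cancels. The shift
  \<open>c\<close> allows for the weight change under a power of \<open>weitz n\<close>.\<close>

lemma sum_weight_spaces_eq_0:
  fixes g :: "int \<Rightarrow> 'k::field_char_0 mpol"
  assumes "finite M" "\<And>\<mu>. \<mu> \<in> M \<Longrightarrow> g \<mu> \<in> weitz.weight_space n (\<mu> + c)"
    and "(\<Sum>\<mu>\<in>M. g \<mu>) = 0" "\<nu> \<in> M"
  shows "g \<nu> = 0"
proof (rule poly_mapping_eqI)
  fix \<alpha>
  have other: "Poly_Mapping.lookup (g \<mu>) \<alpha> = 0" if "\<mu> \<in> M" "weight n \<alpha> \<noteq> \<mu> + c" for \<mu>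
    using assms(2)[OF that(1)] that(2) by (auto simp: mem_weight_space_iff in_keys_iff)
  have "Poly_Mapping.lookup (g \<nu>) \<alpha> = (\<Sum>\<mu>\<in>M. Poly_Mapping.lookup (g \<mu>) \<alpha>)" if "weight n \<alpha> = \<nu> + c"
    using assms(1,4) that other by (subst sum.remove[of M \<nu>]) (auto intro!: sum.neutral)
  also have "\<dots> = 0"
    by (simp add: assms(3) flip: lookup_sum)
  finally show "Poly_Mapping.lookup (g \<nu>) \<alpha> = Poly_Mapping.lookup 0 \<alpha>"
    using other assms(4) by (cases "weight n \<alpha> = \<nu> + c") auto
qed

subsection \<open>The polynomial ring in finitely many variables\<close>

lemma mem_poly_ring:
  "p \<in> carrier (poly_ring n) \<longleftrightarrow> (\<forall>\<alpha>\<in>Poly_Mapping.keys p. Poly_Mapping.keys \<alpha> \<subseteq> {1..n})"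
  by (simp add: poly_ring_def)

lemma poly_ring_simps [simp]:
  "mult (poly_ring n) = (*)" "one (poly_ring n) = 1" "zero (poly_ring n) = 0" "add (poly_ring n) = (+)"
  by (simp_all add: poly_ring_def)

lemma poly_ring_add:
  "p \<in> carrier (poly_ring n) \<Longrightarrow> q \<in> carrier (poly_ring n) \<Longrightarrow> p + q \<in> carrier (poly_ring n)"
  using Poly_Mapping.keys_add[of p q] by (fastforce simp: mem_poly_ring)

lemma poly_ring_uminus: "p \<in> carrier (poly_ring n) \<Longrightarrow> - p \<in> carrier (poly_ring n)"
  by (simp add: mem_poly_ring)

lemma poly_ring_zero: "0 \<in> carrier (poly_ring n)"
  by (simp add: mem_poly_ring)

lemma poly_ring_sum:
  "(\<And>x. x \<in> X \<Longrightarrow> f x \<in> carrier (poly_ring n)) \<Longrightarrow> sum f X \<in> carrier (poly_ring n)"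
  by (induction X rule: infinite_finite_induct) (auto simp: poly_ring_zero poly_ring_add)

lemma poly_ring_single:
  "Poly_Mapping.keys \<alpha> \<subseteq> {1..n} \<Longrightarrow> Poly_Mapping.single \<alpha> c \<in> carrier (poly_ring n)"
  by (simp add: mem_poly_ring)

lemma poly_ring_one: "1 \<in> carrier (poly_ring n)"
  using poly_ring_single[of 0 n 1] by (simp add: single_one)

lemma poly_ring_mult:
  assumes "p \<in> carrier (poly_ring n)" "q \<in> carrier (poly_ring n)"
  shows "p * q \<in> carrier (poly_ring n)"
  unfolding mem_poly_ring
proof
  fix \<gamma> assume "\<gamma> \<in> Poly_Mapping.keys (p * q)"
  then obtain \<alpha> \<beta> where "\<gamma> = \<alpha> + \<beta>" "\<alpha> \<in> Poly_Mapping.keys p" "\<beta> \<in> Poly_Mapping.keys q"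
    using Poly_Mapping.keys_mult[of p q] by blast
  then show "Poly_Mapping.keys \<gamma> \<subseteq> {1..n}"
    using assms Poly_Mapping.keys_add[of \<alpha> \<beta>] unfolding mem_poly_ring by blast
qed

lemma poly_ring_partial_deriv:
  assumes "p \<in> carrier (poly_ring n)"
  shows "partial_deriv i p \<in> carrier (poly_ring n)"
  unfolding partial_deriv_def
proof (intro poly_ring_sum poly_ring_single)
  fix \<alpha> assume "\<alpha> \<in> Poly_Mapping.keys p"
  then have "Poly_Mapping.keys \<alpha> \<subseteq> {1..n}" using assms by (simp add: mem_poly_ring)
  moreover have "Poly_Mapping.keys (\<alpha> - Poly_Mapping.single i 1) \<subseteq> Poly_Mapping.keys \<alpha>"
    by (auto simp: in_keys_iff lookup_minus)
  ultimately show "Poly_Mapping.keys (\<alpha> - Poly_Mapping.single i 1) \<subseteq> {1..n}" by simp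
qed

lemma poly_ring_var: "i \<in> {1..n} \<Longrightarrow> var i \<in> carrier (poly_ring n)"
  unfolding var_def by (rule poly_ring_single) simp

lemma poly_ring_weitz: "p \<in> carrier (poly_ring n) \<Longrightarrow> weitz n p \<in> carrier (poly_ring n)"
  unfolding weitz_def
  by (intro poly_ring_sum poly_ring_mult poly_ring_partial_deriv poly_ring_var) auto

lemma poly_ring_weitz_hat:
  assumes "p \<in> carrier (poly_ring n)"
  shows "weitz_hat n p \<in> carrier (poly_ring n)"
  unfolding weitz_hat_def
proof (intro poly_ring_sum)
  fix i assume i: "i \<in> {1..n}"
  show "of_nat (i * (n - i)) * var (i + 1) * partial_deriv i p \<in> carrier (poly_ring n)"
  \<comment> \<open>For i = n the variable lies outside the ring, but its coefficient is 0.\<close>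
  proof (cases "i = n")
    case False
    then have "var (i + 1) \<in> carrier (poly_ring n)" using i by (intro poly_ring_var) auto
    then show ?thesis
      unfolding of_nat_mpol
      by (intro poly_ring_mult poly_ring_partial_deriv assms poly_ring_single) auto
  qed (simp add: poly_ring_zero)
qed

lemma poly_ring_weitz_hat_pow:
  "p \<in> carrier (poly_ring n) \<Longrightarrow> (weitz_hat n ^^ j) p \<in> carrier (poly_ring n)"
  by (induction j) (auto simp: poly_ring_weitz_hat)

lemma poly_ring_abelian_group: "abelian_group (poly_ring n)"
proof (rule abelian_groupI)
  fix x assume "x \<in> carrier (poly_ring n :: 'a mpol ring)"
  then show "\<exists>y\<in>carrier (poly_ring n). y \<oplus>\<^bsub>poly_ring n\<^esub> x = \<zero>\<^bsub>poly_ring n\<^esub>"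
    by (intro bexI[of _ "- x"]) (auto simp: poly_ring_uminus)
qed (auto simp: poly_ring_add poly_ring_zero add_ac)

lemma poly_ring_cring: "cring (poly_ring n)"
proof (rule cringI[OF poly_ring_abelian_group])
  show "comm_monoid (poly_ring n)"
    by (rule comm_monoidI) (auto simp: poly_ring_mult poly_ring_one mult_ac)
qed (simp add: distrib_right)

lemma poly_ring_a_inv: "p \<in> carrier (poly_ring n) \<Longrightarrow> \<ominus>\<^bsub>poly_ring n\<^esub> p = - p"
  by (rule abelian_group.minus_equality[OF poly_ring_abelian_group]) (auto simp: poly_ring_uminus)

subsection \<open>The kernels of the powers of the derivation\<close>

lemma weitz_ker_zero: "0 \<in> (weitz_ker n i :: 'k mpol set)"
  and weitz_ker_add: "p \<in> weitz_ker n i \<Longrightarrow> q \<in> weitz_ker n i \<Longrightarrow> p + q \<in> weitz_ker n i"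
  for p q :: "'k::field_char_0 mpol"
  by (auto simp: weitz_ker_def poly_ring_zero poly_ring_add weitz.E_pow_add)

lemma weitz_ker_const: "i \<ge> 1 \<Longrightarrow> Poly_Mapping.single 0 c \<in> weitz_ker n i" for c :: "'k::field_char_0"
  using weitz.E_pow_eq_0_mono[of 1 n "Poly_Mapping.single 0 c" i]
  by (simp add: weitz_ker_def poly_ring_single derivation_const[OF derivation_weitz])

lemma weitz_ker_one: "i \<ge> 1 \<Longrightarrow> 1 \<in> (weitz_ker n i :: 'k::field_char_0 mpol set)"
  using weitz_ker_const[of i 1] by (simp add: single_one)

text \<open>The kernels form a filtration in which the orders minus one add up. With a = 1 it gives
  the module action.\<close>

lemma weitz_ker_mult:
  assumes "p \<in> weitz_ker n a" "q \<in> weitz_ker n b" "a + b \<le> Suc c"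
  shows "p * q \<in> weitz_ker n c"
  using assms derivation_pow_mult_eq_0[OF derivation_weitz, of a n p b q c]
  by (auto simp: weitz_ker_def poly_ring_mult)

lemma weitz_ker_smult:
  "c \<in> weitz_ker n 1 \<Longrightarrow> p \<in> weitz_ker n i \<Longrightarrow> c * p \<in> weitz_ker n i"
  by (rule weitz_ker_mult) auto

lemma weitz_ker_uminus: "p \<in> weitz_ker n i \<Longrightarrow> - p \<in> weitz_ker n i" for p :: "'k::field_char_0 mpol"
  using weitz_ker_smult[OF weitz_ker_const[of 1 "- 1"], of p n i] by (simp add: single_uminus single_one)

lemma weitz_ker_mono: "i \<le> j \<Longrightarrow> weitz_ker n i \<subseteq> (weitz_ker n j :: 'k::field_char_0 mpol set)"
  using weitz.E_pow_eq_0_mono by (auto simp: weitz_ker_def)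

lemma ker_ring_simps [simp]:
  "carrier (ker_ring n) = weitz_ker n 1" "mult (ker_ring n) = (*)" "one (ker_ring n) = 1"
  "zero (ker_ring n) = 0" "add (ker_ring n) = (+)"
  by (simp_all add: ker_ring_def)

lemma ker_module_simps [simp]:
  "carrier (ker_module n i) = weitz_ker n i" "zero (ker_module n i) = 0"
  "add (ker_module n i) = (+)" "smult (ker_module n i) = (*)"
  by (simp_all add: ker_module_def)

lemma ker_ring_cring: "cring (ker_ring n :: 'k::field_char_0 mpol ring)"
proof (intro cringI abelian_groupI comm_monoidI)
  fix x assume "x \<in> carrier (ker_ring n :: 'k mpol ring)"
  then show "\<exists>y\<in>carrier (ker_ring n). y \<oplus>\<^bsub>ker_ring n\<^esub> x = \<zero>\<^bsub>ker_ring n\<^esub>"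
    by (intro bexI[of _ "- x"]) (auto simp: weitz_ker_uminus simp del: One_nat_def)
qed (auto simp: weitz_ker_add weitz_ker_zero weitz_ker_one weitz_ker_smult algebra_simps simp del: One_nat_def)

lemma ker_module_module: "Module.module (ker_ring n :: 'k::field_char_0 mpol ring) (ker_module n i)"
proof (intro moduleI ker_ring_cring abelian_groupI)
  fix x assume "x \<in> carrier (ker_module n i :: ('k mpol, 'k mpol) module)"
  then show "\<exists>y\<in>carrier (ker_module n i). y \<oplus>\<^bsub>ker_module n i\<^esub> x = \<zero>\<^bsub>ker_module n i\<^esub>"
    by (intro bexI[of _ "- x"]) (auto simp: weitz_ker_uminus)
qed (auto simp: weitz_ker_add weitz_ker_zero weitz_ker_smult algebra_simps simp del: One_nat_def)

lemma submodule_ker_module: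
  assumes "submodule T (ker_ring n) (ker_module n i)"
  shows "0 \<in> T" "p \<in> T \<Longrightarrow> q \<in> T \<Longrightarrow> p + q \<in> T"
    "c \<in> weitz_ker n 1 \<Longrightarrow> p \<in> T \<Longrightarrow> c * p \<in> T"
  using assms subgroup.one_closed[of T "add_monoid (ker_module n i)"]
    subgroup.m_closed[of T "add_monoid (ker_module n i)" p q]
  by (auto simp: submodule_def submodule_axioms_def)

subsection \<open>Products of the iterated images of the generators\<close>

text \<open>An isobaric element of the kernel is a highest weight vector, so e + 1 applications of
  \<open>weitz n\<close> undo and then kill \<open>(weitz_hat n ^^ e) p\<close>. For e = 0 the
  factor is 1.\<close>

lemma hat_factor_in_weitz_ker:
  fixes p :: "'k::field_char_0 mpol"
  assumes "p \<in> weitz_ker n 1" "isobaric n p"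
  shows "hat_factor n e p \<in> weitz_ker n (Suc e)"
proof (cases "e = 0")
  case True
  then show ?thesis using weitz_ker_one[of 1 n] by (simp add: hat_factor_def)
next
  case False
  obtain \<mu> where "p \<in> weitz.weight_space n \<mu>"
    using assms(2) unfolding isobaric_def mem_weight_space_iff by blast
  then have "(weitz n ^^ Suc e) ((weitz_hat n ^^ e) p) = 0"
    using assms(1) by (intro weitz.E_pow_F_pow_eq_0) (auto simp: weitz_ker_def)
  then show ?thesis
    using False assms(1) unfolding hat_factor_def weitz_ker_def
    by (simp add: poly_ring_weitz_hat_pow del: funpow.simps)
qed

lemma hat_products_subset_weitz_ker:
  fixes a :: "nat \<Rightarrow> 'k::field_char_0 mpol"
  assumes a: "\<forall>m\<in>{1..k}. a m \<in> weitz_ker n 1 \<and> isobaric n (a m)" and "i \<ge> 1"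
  shows "hat_products n k a i \<subseteq> weitz_ker n i"
proof
  fix s assume "s \<in> hat_products n k a i"
  then obtain fs where fs: "fst ` set fs \<subseteq> {1..k}" "sum_list (map snd fs) \<le> i - 1"
      "s = prod_list (map (\<lambda>(m, e). hat_factor n e (a m)) fs)"
    by (auto simp: hat_products_def)
  from fs(1) have "prod_list (map (\<lambda>(m, e). hat_factor n e (a m)) fs) \<in> weitz_ker n (Suc (sum_list (map snd fs)))"
  proof (induction fs)
    case Nil
    then show ?case using weitz_ker_one[of 1 n] by simp
  next
    case (Cons f fs)
    obtain m e where f: "f = (m, e)" by (cases f)
    then have "hat_factor n e (a m) \<in> weitz_ker n (Suc e)"
      using Cons.prems a by (intro hat_factor_in_weitz_ker) auto
    from weitz_ker_mult[OF this Cons.IH] Cons.prems show ?case by (simp add: f)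
  qed
  \<comment> \<open>The hypothesis \<open>i \<ge> 1\<close> keeps \<open>i - 1\<close> from
    truncating.\<close>
  moreover have "Suc (sum_list (map snd fs)) \<le> i"
    using fs(2) \<open>i \<ge> 1\<close> by simp
  ultimately show "s \<in> weitz_ker n i"
    using weitz_ker_mono unfolding fs(3) by blast
qed

lemma hat_products_mono: "i \<le> j \<Longrightarrow> hat_products n k a i \<subseteq> hat_products n k a j"
  by (fastforce simp: hat_products_def)

text \<open>Lists are concatenated. The index exceeds the bound on the total order by one, hence the
  \<open>Suc\<close>.\<close>

lemma hat_products_mult:
  assumes "s \<in> hat_products n k a (Suc p)" "t \<in> hat_products n k a (Suc q)"
  shows "s * t \<in> hat_products n k a (Suc (p + q))"
proof -
  from assms obtain fs gs where "fs \<noteq> []" "fst ` set fs \<subseteq> {1..k}" "sum_list (map snd fs) \<le> p"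
      "s = prod_list (map (\<lambda>(m, e). hat_factor n e (a m)) fs)"
      "fst ` set gs \<subseteq> {1..k}" "sum_list (map snd gs) \<le> q"
      "t = prod_list (map (\<lambda>(m, e). hat_factor n e (a m)) gs)"
    unfolding hat_products_def by auto
  then show ?thesis
    unfolding hat_products_def by (intro CollectI exI[of _ "fs @ gs"]) (auto simp: image_Un)
qed

text \<open>The list must be nonempty, so 1 is written as the factor of exponent 0 at some
  generator.\<close>

lemma one_in_hat_products: "k \<ge> 1 \<Longrightarrow> 1 \<in> hat_products n k a i"
  unfolding hat_products_def by (intro CollectI exI[of _ "[(1, 0)]"]) (auto simp: hat_factor_def)

text \<open>Here \<open>j\<close> bounds the total order itself, whence \<open>Suc j\<close> in
  \<open>hat_products\<close>. Building combinations term by term gives induction on the number of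
  terms.\<close>

inductive_set hat_span :: "nat \<Rightarrow> nat \<Rightarrow> (nat \<Rightarrow> 'k::comm_ring_1 mpol) \<Rightarrow> nat \<Rightarrow> 'k mpol set"
  for n k :: nat and a :: "nat \<Rightarrow> 'k mpol" and j :: nat where
  zero: "0 \<in> hat_span n k a j"
| add_term: "p \<in> hat_span n k a j \<Longrightarrow> c \<in> weitz_ker n 1 \<Longrightarrow> s \<in> hat_products n k a (Suc j)
    \<Longrightarrow> p + c * s \<in> hat_span n k a j"

lemma hat_span_add:
  assumes "p \<in> hat_span n k a j" "q \<in> hat_span n k a j"
  shows "p + q \<in> hat_span n k a j"
  using assms(2)
proof induction
  case (add_term q c s)
  then show ?case using hat_span.add_term[of "p + q"] by (simp add: add.assoc)
qed (simp add: assms(1))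

lemma hat_span_term:
  "c \<in> weitz_ker n 1 \<Longrightarrow> s \<in> hat_products n k a (Suc j) \<Longrightarrow> c * s \<in> hat_span n k a j"
  using hat_span.add_term[OF hat_span.zero] by fastforce

lemma hat_span_smult:
  assumes "c \<in> weitz_ker n 1" "p \<in> hat_span n k a j"
  shows "c * p \<in> hat_span n k a j"
  using assms(2)
proof induction
  case (add_term p d s)
  then show ?case
    using hat_span.add_term[of "c * p" n k a j "c * d"] weitz_ker_smult[OF assms(1)]
    by (simp add: distrib_left mult.assoc)
qed (simp add: hat_span.zero)

lemma hat_span_mult_hat_products:
  assumes "t \<in> hat_products n k a (Suc j)" "p \<in> hat_span n k a i"
  shows "p * t \<in> hat_span n k a (i + j)"
  using assms(2)
proof induction
  case (add_term p c s)
  then show ?case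
    using hat_span.add_term[of "p * t" n k a "i + j" c "s * t"] hat_products_mult[OF _ assms(1)]
    by (simp add: distrib_right mult.assoc)
qed (simp add: hat_span.zero)

lemma hat_span_mult:
  assumes "p \<in> hat_span n k a i" "q \<in> hat_span n k a j"
  shows "p * q \<in> hat_span n k a (i + j)"
  using assms(2)
proof induction
  case (add_term q c s)
  then have "c * (p * s) \<in> hat_span n k a (i + j)"
    using hat_span_smult hat_span_mult_hat_products assms(1) by blast
  then show ?case using hat_span_add[OF add_term.IH] by (simp add: distrib_left mult_ac)
qed (simp add: hat_span.zero)

text \<open>Total order at most \<open>j\<close> fits the bound \<open>i - 1\<close>, and a
  submodule absorbs combinations term by term.\<close>

lemma hat_span_subset_submodule:
  assumes T: "submodule T (ker_ring n) (ker_module n i)" "hat_products n k a i \<subseteq> T" and "j < i"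
  shows "hat_span n k a j \<subseteq> T"
proof
  fix p assume "p \<in> hat_span n k a j"
  then show "p \<in> T"
  proof induction
    case (add_term p c s)
    then have "s \<in> T" using hat_products_mono[of "Suc j" i n k a] T(2) \<open>j < i\<close> by auto
    then show ?case using add_term submodule_ker_module[OF T(1)] by blast
  qed (rule submodule_ker_module(1)[OF T(1)])
qed

text \<open>The shifts \<open>s\<close> and \<open>t\<close> let one step of the Leibniz rule pass from \<open>p\<close> to its image.\<close>

lemma weitz_hat_pow_mult_in_hat_span:
  assumes "\<And>r. (weitz_hat n ^^ r) p \<in> hat_span n k a (r + s)"
    and "\<And>r. (weitz_hat n ^^ r) q \<in> hat_span n k a (r + t)"
  shows "(weitz_hat n ^^ j) (p * q) \<in> hat_span n k a (j + s + t)"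
  using assms
proof (induction j arbitrary: p q s t)
  case 0
  then show ?case using hat_span_mult[of p n k a s q t] by (metis add_0 funpow_0)
next
  case (Suc j)
  have "(weitz_hat n ^^ j) (weitz_hat n p * q) \<in> hat_span n k a (j + Suc s + t)"
    using Suc.prems(1)[of "Suc _"] Suc.prems(2)
    by (intro Suc.IH) (simp_all add: funpow_Suc_right del: funpow.simps)
  moreover have "(weitz_hat n ^^ j) (p * weitz_hat n q) \<in> hat_span n k a (j + s + Suc t)"
    using Suc.prems(2)[of "Suc _"] Suc.prems(1)
    by (intro Suc.IH) (simp_all add: funpow_Suc_right del: funpow.simps)
  ultimately have "(weitz_hat n ^^ j) (weitz_hat n p * q) + (weitz_hat n ^^ j) (p * weitz_hat n q)
      \<in> hat_span n k a (Suc j + s + t)"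
    by (intro hat_span_add) simp_all
  then show ?case
    by (simp add: funpow_Suc_right weitz_hat_mult weitz_hat_pow_add del: funpow.simps)
qed

text \<open>The kernel elements with this property for all \<open>j\<close> form a subalgebra
  containing the generators, hence are the whole kernel. Closure under products is the Leibniz lemma
  with both shifts 0.\<close>

lemma weitz_hat_pow_ker_in_hat_span:
  fixes a :: "nat \<Rightarrow> 'k::field_char_0 mpol"
  assumes "k \<ge> 1" and a: "\<forall>m\<in>{1..k}. a m \<in> weitz_ker n 1"
    and gen: "generated_subalgebra n (a ` {1..k}) = weitz_ker n 1"
    and p: "p \<in> weitz_ker n 1"
  shows "(weitz_hat n ^^ j) p \<in> hat_span n k a j"
proof -
  define B where "B = {p \<in> weitz_ker n 1. \<forall>j. (weitz_hat n ^^ j) p \<in> hat_span n k a j}"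
  have const: "Poly_Mapping.single 0 c \<in> B" for c
  proof -
    have "(weitz_hat n ^^ j) (Poly_Mapping.single 0 c) \<in> hat_span n k a j" for j
    proof (cases j)
      case 0
      then show ?thesis
        using hat_span_term[OF weitz_ker_const[of 1 c] one_in_hat_products[OF \<open>k \<ge> 1\<close>]] by simp
    next
      case (Suc r)
      then show ?thesis
        by (simp add: funpow_Suc_right derivation_const[OF derivation_weitz_hat] hat_span.zero del: funpow.simps)
    qed
    then show ?thesis by (simp add: B_def weitz_ker_const del: One_nat_def)
  qed
  have mult: "p * q \<in> B" if "p \<in> B" "q \<in> B" for p q
    using that weitz_hat_pow_mult_in_hat_span[of n p k a 0 q 0]
    by (simp add: B_def weitz_ker_smult del: One_nat_def)
  have add: "p + q \<in> B" if "p \<in> B" "q \<in> B" for p q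
    using that by (simp add: B_def weitz_ker_add weitz_hat_pow_add hat_span_add)
  have uminus: "- p \<in> B" if "p \<in> B" for p
    using mult[OF const[of "- 1"] that] by (simp add: single_uminus single_one)
  have carrier: "B \<subseteq> carrier (poly_ring n)"
    by (auto simp: B_def weitz_ker_def)
  interpret R: cring "poly_ring n :: 'k mpol ring" by (rule poly_ring_cring)
  have "subring B (poly_ring n)"
    using carrier const[of 1] uminus mult add
    by (intro R.subringI) (auto simp: poly_ring_a_inv single_one subset_iff)
  moreover from this have "subalgebra constants B (poly_ring n)"
    using const mult by (auto simp: subring_def subalgebra_def subalgebra_axioms_def constants_def)
  moreover have "a ` {1..k} \<subseteq> B"
  proof
    fix x assume "x \<in> a ` {1..k}"
    then obtain m where m: "m \<in> {1..k}" "x = a m" by blast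
    have "(weitz_hat n ^^ j) x \<in> hat_span n k a j" for j
    proof (cases "j = 0")
      case True
      \<comment> \<open>Since \<open>hat_factor\<close> at exponent 0 is 1, the generator itself
        enters as a coefficient of the product 1.\<close>
      then show ?thesis
        using hat_span_term[of x n 1 k a 0] one_in_hat_products[OF \<open>k \<ge> 1\<close>, of n a "Suc 0"] a m by simp
    next
      case False
      then have "(weitz_hat n ^^ j) x \<in> hat_products n k a (Suc j)"
        unfolding hat_products_def using m
        by (intro CollectI exI[of _ "[(m, j)]"]) (auto simp: hat_factor_def)
      from hat_span_term[OF weitz_ker_one this] show ?thesis by simp
    qed
    then show "x \<in> B" using a m by (simp add: B_def)
  qed
  ultimately have "generated_subalgebra n (a ` {1..k}) \<subseteq> B"
    unfolding generated_subalgebra_def by (intro hull_minimal) auto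
  then show ?thesis using p gen by (auto simp: B_def)
qed

section \<open>Nonempty systems of generators and the final assembly\<close>

lemma weitz_ker_1_not_subset_constants:
  assumes "n \<ge> 1"
  shows "\<not> weitz_ker n 1 \<subseteq> (constants :: 'k::field_char_0 mpol set)"
proof
  assume "weitz_ker n 1 \<subseteq> (constants :: 'k mpol set)"
  moreover have "var 1 \<in> (weitz_ker n 1 :: 'k mpol set)"
    using assms by (simp add: weitz_ker_def poly_ring_var weitz_var)
  ultimately obtain c :: 'k where "var 1 = Poly_Mapping.single 0 c"
    by (auto simp: constants_def)
  then have "partial_deriv 1 (var 1 :: 'k mpol) = 0" by simp
  then show False by (simp add: partial_deriv_var)
qed

lemma generated_subalgebra_empty: "generated_subalgebra n {} \<subseteq> (constants :: 'k::field_char_0 mpol set)"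
proof -
  interpret R: cring "poly_ring n :: 'k mpol ring" by (rule poly_ring_cring)
  have "subring constants (poly_ring n :: 'k mpol ring)"
  proof (rule R.subringI)
    show sub: "constants \<subseteq> carrier (poly_ring n :: 'k mpol ring)"
      by (auto simp: constants_def poly_ring_single)
    show "\<one>\<^bsub>poly_ring n\<^esub> \<in> (constants :: 'k mpol set)"
      unfolding constants_def by (intro range_eqI[of _ _ 1]) (simp add: single_one)
    fix p q :: "'k mpol" assume "p \<in> constants" "q \<in> constants"
    then obtain b c where [simp]: "p = Poly_Mapping.single 0 b" "q = Poly_Mapping.single 0 c"
      by (auto simp: constants_def)
    show "p \<otimes>\<^bsub>poly_ring n\<^esub> q \<in> constants" "p \<oplus>\<^bsub>poly_ring n\<^esub> q \<in> constants"
      by (auto simp: constants_def mult_single simp flip: single_add)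
    show "\<ominus>\<^bsub>poly_ring n\<^esub> p \<in> constants"
      by (auto simp: poly_ring_a_inv poly_ring_single constants_def simp flip: single_uminus)
  qed
  moreover from this have "subalgebra constants constants (poly_ring n :: 'k mpol ring)"
    by (auto simp: subring_def subalgebra_def subalgebra_axioms_def constants_def mult_single)
  ultimately show ?thesis
    unfolding generated_subalgebra_def by (intro hull_minimal) auto
qed

text \<open>Since \<open>weitz n\<close> raises weights by 2, every isobaric component of
  \<open>f\<close> lies in the same kernel. The sl2 decomposition applies to each component.\<close>

lemma weitz_ker_decomposition:
  fixes f :: "'k::field_char_0 mpol"
  assumes f: "f \<in> weitz_ker n i"
    and zero: "0 \<in> T" and add: "\<And>p q. p \<in> T \<Longrightarrow> q \<in> T \<Longrightarrow> p + q \<in> T"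
    and hat: "\<And>j g. j < i \<Longrightarrow> g \<in> weitz_ker n 1 \<Longrightarrow> (weitz_hat n ^^ j) g \<in> T"
  shows "f \<in> T"
proof -
  have sum: "sum h X \<in> T" if "\<And>x. x \<in> X \<Longrightarrow> h x \<in> T" for h and X :: "'c set"
    using that by (induction X rule: infinite_finite_induct) (auto intro: zero add)
  define M where "M = weight n ` Poly_Mapping.keys f"
  define c where "c \<mu> = (\<Sum>\<alpha>\<in>{\<alpha>\<in>Poly_Mapping.keys f. weight n \<alpha> = \<mu>}.
    Poly_Mapping.single \<alpha> (Poly_Mapping.lookup f \<alpha>))" for \<mu>
  have f_sum: "f = (\<Sum>\<mu>\<in>M. c \<mu>)"
    unfolding M_def c_def by (subst sum.image_gen[symmetric]) (auto simp flip: mpol_expand)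
  have c_carrier: "c \<mu> \<in> carrier (poly_ring n)" for \<mu>
    using f unfolding c_def by (intro poly_ring_sum poly_ring_single) (auto simp: weitz_ker_def mem_poly_ring)
  have c_weight: "c \<mu> \<in> weitz.weight_space n \<mu>" for \<mu>
  proof -
    have "Poly_Mapping.keys (c \<mu>) \<subseteq> {\<alpha>\<in>Poly_Mapping.keys f. weight n \<alpha> = \<mu>}"
      unfolding c_def by (rule order_trans[OF keys_sum]) (auto split: if_splits)
    then show ?thesis by (auto simp: mem_weight_space_iff)
  qed
  \<comment> \<open>The images have distinct weights \<mu> + 2i and sum to
    \<open>(weitz n ^^ i) f = 0\<close>, so each vanishes.\<close>
  have c_ker: "(weitz n ^^ i) (c \<mu>) = 0" if "\<mu> \<in> M" for \<mu>
  proof (rule sum_weight_spaces_eq_0[where g = "\<lambda>\<mu>. (weitz n ^^ i) (c \<mu>)" and M = M and n = n and c = "2 * int i"])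
    show "(\<Sum>\<mu>\<in>M. (weitz n ^^ i) (c \<mu>)) = 0"
      using f by (simp add: weitz_ker_def f_sum flip: weitz.E_pow_sum)
  qed (use that in \<open>auto simp: M_def intro: weitz.E_pow_weight_space c_weight\<close>)
  have "c \<mu> \<in> T" if "\<mu> \<in> M" for \<mu>
  proof -
    \<comment> \<open>The polynomials in n variables serve as the invariant subspace
      \<open>U\<close>.\<close>
    have "weitz.subspace (carrier (poly_ring n))"
      by (rule weitz.subspaceI) (auto simp: poly_ring_zero poly_ring_add poly_ring_mult poly_ring_single)
    then have "\<exists>g. (\<forall>j<i. g j \<in> carrier (poly_ring n) \<and> weitz n (g j) = 0)
        \<and> c \<mu> = (\<Sum>j<i. (weitz_hat n ^^ j) (g j))"
      by (rule weitz.ker_E_pow_decomposition[OF _ poly_ring_weitz poly_ring_weitz_hat _ c_carrier c_weight])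
        (auto simp: weitz_hat_locally_nilpotent c_ker[OF that])
    then obtain g where g: "\<And>j. j < i \<Longrightarrow> g j \<in> carrier (poly_ring n) \<and> weitz n (g j) = 0"
        "c \<mu> = (\<Sum>j<i. (weitz_hat n ^^ j) (g j))"
      by blast
    then show ?thesis
      unfolding g(2) by (intro sum hat) (auto simp: weitz_ker_def)
  qed
  then show ?thesis using f_sum sum by metis
qed

theorem theorem2:
  fixes n k :: nat and a :: "nat \<Rightarrow> 'k::{alg_closed_field, field_char_0} mpol"
  assumes "n \<ge> 1"
    and "\<forall>m\<in>{1..k}. a m \<in> weitz_ker n 1 \<and> isobaric n (a m)"
    and "generated_subalgebra n (a ` {1..k}) = weitz_ker n 1"
  shows "\<forall>i\<ge>1. Module.module (ker_ring n :: 'k mpol ring) (ker_module n i)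
    \<and> hat_products n k a i \<subseteq> weitz_ker n i
    \<and> generated_submodule (ker_ring n :: 'k mpol ring) (ker_module n i) (hat_products n k a i)
        = weitz_ker n i"
proof (intro allI impI conjI)
  fix i :: nat assume "i \<ge> 1"
  show module: "Module.module (ker_ring n :: 'k mpol ring) (ker_module n i)"
    by (rule ker_module_module)
  show products: "hat_products n k a i \<subseteq> weitz_ker n i"
    using assms(2) \<open>i \<ge> 1\<close> by (rule hat_products_subset_weitz_ker)
  \<comment> \<open>Without generators the subalgebra would consist of constants, but
    \<open>var 1\<close> lies in the kernel.\<close>
  have "k \<noteq> 0"
    using assms(3) weitz_ker_1_not_subset_constants[OF assms(1), where 'k = 'k]
      generated_subalgebra_empty[of n, where 'k = 'k] by (metis atLeastatMost_empty image_empty less_one)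
  show "generated_submodule (ker_ring n) (ker_module n i) (hat_products n k a i) = weitz_ker n i"
    unfolding generated_submodule_def
  \<comment> \<open>The kernel is itself a submodule containing the products; the decomposition
    shows that it lies in every other such \<open>T\<close>.\<close>
  proof (rule hull_unique)
    show "submodule (weitz_ker n i) (ker_ring n) (ker_module n i :: ('k mpol, 'k mpol) module)"
      using module.carrier_is_submodule[OF module] by simp
    fix T assume T: "hat_products n k a i \<subseteq> T" "submodule T (ker_ring n) (ker_module n i)"
    show "weitz_ker n i \<subseteq> T"
    proof
      fix f :: "'k mpol" assume "f \<in> weitz_ker n i"
      then show "f \<in> T"
      proof (rule weitz_ker_decomposition)
        fix j and g :: "'k mpol" assume "j < i" "g \<in> weitz_ker n 1"
        then show "(weitz_hat n ^^ j) g \<in> T"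
          using weitz_hat_pow_ker_in_hat_span[of k a n g j] hat_span_subset_submodule[OF T(2,1)]
            assms(2,3) \<open>k \<noteq> 0\<close> by auto
      qed (use submodule_ker_module[OF T(2)] in auto)
    qed
  qed (rule products)
qed

end
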